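(* Let $r\geq 2$ and $t,T\geq 1$ be integers with $T\geq rt+r-1$, and let $\mathcal{H}$ be the complete $r$-partite graph $K_{t,\ldots,t,T}$ (with $r-1$ parts of size $t$ and one part of size $T$). Then $\operatorname{cd}^r(\mathcal{H})=0$, while $$\chi(\operatorname{KG}^r(\mathcal{H}))=\frac{\operatorname{ecd}^r(\mathcal{H})}{r-1}=t.$$
   Context: A graph is viewed as a hypergraph $\mathcal{H}=(V(\mathcal{H}),E(\mathcal{H}))$ with edges of size 2. For $N\subseteq V(\mathcal{H})$, $\mathcal{H}[N]$ is the induced subhypergraph with vertex set $N$ and edges $\{e\in E(\mathcal{H}): e\subseteq N\}$. A proper coloring has no monochromatic edge; $\chi$ is the minimum number of colors in a proper coloring. The general Kneser hypergraph $\operatorname{KG}^r(\mathcal{H})$ has vertex set $E(\mathcal{H})$ and edge set $\{\{e_1,\ldots,e_r\}: e_i\in E(\mathcal{H}),\ e_i\cap e_j=\varnothing \text{ for all } i\neq j\}$. The $r$-colorability defect $\operatorname{cd}^r(\mathcal{H})$ is the minimum number of vertices that must be removed from $\mathcal{H}$ so that the induced subhypergraph on the remaining vertices is properly $r$-colorable. The equitable $r$-colorability defect $\operatorname{ecd}^r(\mathcal{H})$ is the minimum number of vertices that must be removed so that the induced subhypergraph on the remaining vertices has an equitable $r$-coloring, i.e. a proper coloring with $r$ (possibly empty) color classes whose sizes pairwise differ by at most one. *)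

theory Defs
  imports Complex_Main "HOL-Library.Disjoint_Sets"
begin

(* A pair (V, E) of vertices and edges. Hypergraphs are meant to be finite; for infinite
   ones the definitions below based on card or LEAST are not meaningful. *)
type_synonym 'a hypergraph = "'a set \<times> 'a set set"

abbreviation verts :: "'a hypergraph \<Rightarrow> 'a set" where
  "verts \<equiv> fst"

abbreviation edges :: "'a hypergraph \<Rightarrow> 'a set set" where
  "edges \<equiv> snd"

definition induced :: "'a hypergraph \<Rightarrow> 'a set \<Rightarrow> 'a hypergraph" where
  "induced H N = (N, {e \<in> edges H. e \<subseteq> N})"

(* The colors are 0, ..., k - 1; not all of them need to be used. *)
definition proper_coloring :: "'a hypergraph \<Rightarrow> nat \<Rightarrow> ('a \<Rightarrow> nat) \<Rightarrow> bool" where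
  "proper_coloring H k c \<longleftrightarrow>
     (\<forall>v \<in> verts H. c v < k) \<and> (\<forall>e \<in> edges H. \<not> (\<exists>i. \<forall>v \<in> e. c v = i))"

definition colorable :: "nat \<Rightarrow> 'a hypergraph \<Rightarrow> bool" where
  "colorable k H \<longleftrightarrow> (\<exists>c. proper_coloring H k c)"

definition chromatic_number :: "'a hypergraph \<Rightarrow> nat" where
  "chromatic_number H = (LEAST k. colorable k H)"

definition equitably_colorable :: "nat \<Rightarrow> 'a hypergraph \<Rightarrow> bool" where
  "equitably_colorable r H \<longleftrightarrow>
     (\<exists>c. proper_coloring H r c \<and>
       (\<forall>i < r. \<forall>j < r. card {v \<in> verts H. c v = i} \<le> card {v \<in> verts H. c v = j} + 1))"

definition colorability_defect :: "nat \<Rightarrow> 'a hypergraph \<Rightarrow> nat" where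
  "colorability_defect r H =
     (LEAST d. \<exists>S \<subseteq> verts H. finite S \<and> card S = d \<and> colorable r (induced H (verts H - S)))"

definition equitable_colorability_defect :: "nat \<Rightarrow> 'a hypergraph \<Rightarrow> nat" where
  "equitable_colorability_defect r H =
     (LEAST d. \<exists>S \<subseteq> verts H. finite S \<and> card S = d \<and>
        equitably_colorable r (induced H (verts H - S)))"

definition kneser_hypergraph :: "nat \<Rightarrow> 'a hypergraph \<Rightarrow> 'a set hypergraph" where
  "kneser_hypergraph r H =
     (edges H,
      {f ` {1..r} | f. (\<forall>i \<in> {1..r}. f i \<in> edges H) \<and>
         (\<forall>i \<in> {1..r}. \<forall>j \<in> {1..r}. i \<noteq> j \<longrightarrow> f i \<inter> f j = {})})"

(* H is a copy, on an arbitrary vertex set, of the complete multipartite graph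
   whose i-th part has ns ! i vertices. *)
definition complete_multipartite_graph :: "nat list \<Rightarrow> 'a hypergraph \<Rightarrow> bool" where
  "complete_multipartite_graph ns H \<longleftrightarrow>
     (\<exists>P :: nat \<Rightarrow> 'a set.
        disjoint_family_on P {..<length ns} \<and>
        (\<forall>i < length ns. finite (P i) \<and> card (P i) = ns ! i) \<and>
        verts H = (\<Union>i<length ns. P i) \<and>
        edges H = {{u, v} | u v i j.
          i < length ns \<and> j < length ns \<and> i \<noteq> j \<and> u \<in> P i \<and> v \<in> P j})"

end

(* Color an edge by the block containing one of its vertices in the small parts, where the
   (r - 1) t vertices of these parts are cut into t blocks of size r - 1: this gives
   chi \<le> t. Conversely, a matching of size (r - 1) t between the small parts and the large part
   forces t colors by the pigeonhole principle, so no topological lower bound is needed.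

   For the equitable defect, suppose that q \<ge> 1 small parts survive the removal of S. Every color
   class lies inside one part, so some class has at most t vertices, all classes have at most t + 1,
   and the large part uses at most r - q of them. So S contains at least
   T - (r - q) (t + 1) \<ge> q t + q - 1 vertices of the large part, besides the (r - 1 - q) t
   vertices of the small parts that do not survive, hence at least (r - 1) t + q - 1 vertices in total. *)

theory Submission
  imports Defs
begin

section \<open>Upper and lower bounds on the chromatic number of Kneser hypergraphs\<close>

text \<open>Number the vertex cover \<open>U\<close>, cut the numbers into \<open>k\<close> blocks
  of length \<open>r - 1\<close>, and color an edge by the block of a chosen cover vertex in it. A
  block is too short for the chosen vertices of \<open>r\<close> disjoint edges.\<close>

lemma colorable_kneser_hypergraph_of_cover:
  assumes "r \<ge> 2" and fin: "finite U" and card: "card U \<le> k * (r - 1)"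
    and cover: "\<And>e. e \<in> edges H \<Longrightarrow> e \<inter> U \<noteq> {}"
  shows "colorable k (kneser_hypergraph r H)"
proof -
  obtain h where h: "bij_betw h U {0..<card U}"
    using ex_bij_betw_finite_nat[OF fin] by blast
  have "\<forall>e\<in>edges H. \<exists>v. v \<in> e \<inter> U"
    using cover by blast
  from bchoice[OF this] obtain w where w: "\<And>e. e \<in> edges H \<Longrightarrow> w e \<in> e \<inter> U"
    by blast
  define c where "c e = h (w e) div (r - 1)" for e
  have lt: "c e < k" if "e \<in> edges H" for e
  proof -
    have "h (w e) < card U"
      using w[OF that] h by (auto simp: bij_betw_def)
    then show ?thesis
      unfolding c_def using card by (simp add: less_mult_imp_div_less)
  qed
  have False
    if f: "\<forall>i\<in>{1..r}. f i \<in> edges H"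
      and disj: "\<forall>i\<in>{1..r}. \<forall>j\<in>{1..r}. i \<noteq> j \<longrightarrow> f i \<inter> f j = {}"
      and mono: "\<forall>e\<in>f ` {1..r}. c e = i" for f i
  proof -
    \<comment> \<open>Disjoint edges have distinct chosen vertices, and \<open>h\<close> separates
      these.\<close>
    have "inj_on (\<lambda>j. h (w (f j))) {1..r}"
    proof (rule inj_onI)
      fix a b assume ab: "a \<in> {1..r}" "b \<in> {1..r}" "h (w (f a)) = h (w (f b))"
      have "w (f a) = w (f b)"
        using ab f w h by (metis IntD2 bij_betw_def inj_onD)
      then show "a = b"
        using ab f w disj by (metis IntD1 IntI empty_iff)
    qed
    moreover have "(\<lambda>j. h (w (f j))) ` {1..r} \<subseteq> {i * (r - 1)..<i * (r - 1) + (r - 1)}"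
    proof (rule image_subsetI)
      fix j assume "j \<in> {1..r}"
      then have "h (w (f j)) div (r - 1) = i"
        using mono by (auto simp: c_def)
      then have "h (w (f j)) = i * (r - 1) + h (w (f j)) mod (r - 1)"
        by (metis div_mult_mod_eq)
      moreover have "h (w (f j)) mod (r - 1) < r - 1"
        using \<open>r \<ge> 2\<close> by simp
      ultimately show "h (w (f j)) \<in> {i * (r - 1)..<i * (r - 1) + (r - 1)}"
        by (metis add_less_cancel_left atLeastLessThan_iff le_add1)
    qed
    ultimately have "card {1..r} \<le> card {i * (r - 1)..<i * (r - 1) + (r - 1)}"
      by (metis card_inj_on_le finite_atLeastLessThan)
    then show False
      using \<open>r \<ge> 2\<close> by simp
  qed
  then have "proper_coloring (kneser_hypergraph r H) k c"
    unfolding proper_coloring_def kneser_hypergraph_def using lt by fastforce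
  then show ?thesis
    unfolding colorable_def by blast
qed

text \<open>Any \<open>r\<close> members of the matching \<open>M\<close> form an edge of the Kneser
  hypergraph, so each color occurs at most \<open>r - 1\<close> times on \<open>M\<close>.\<close>

lemma card_matching_le_of_colorable_kneser_hypergraph:
  assumes "r \<ge> 1" and fin: "finite M" and M: "M \<subseteq> edges H" and "disjoint M"
    and col: "colorable k (kneser_hypergraph r H)"
  shows "card M \<le> k * (r - 1)"
proof -
  obtain c where c: "proper_coloring (kneser_hypergraph r H) k c"
    using col unfolding colorable_def by blast
  have fibre: "card {e \<in> M. c e = i} \<le> r - 1" for i
  proof (rule ccontr)
    assume "\<not> card {e \<in> M. c e = i} \<le> r - 1"
    then have "r \<le> card {e \<in> M. c e = i}"
      by linarith
    then obtain N where N: "N \<subseteq> {e \<in> M. c e = i}" "card N = r" "finite N"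
      by (rule obtain_subset_with_card_n)
    then obtain f where f: "bij_betw f {1..r} N"
      using ex_bij_betw_nat_finite_1 by blast
    have f_mem: "f a \<in> M" "c (f a) = i" if "a \<in> {1..r}" for a
      using bij_betwE[OF f] that N(1) by blast+
    then have "f a \<in> edges H" if "a \<in> {1..r}" for a
      using that M by blast
    moreover have "f a \<inter> f b = {}" if "a \<in> {1..r}" "b \<in> {1..r}" "a \<noteq> b" for a b
    proof -
      have "f a \<noteq> f b"
        using that f by (meson bij_betw_def inj_onD)
      then show ?thesis
        using \<open>disjoint M\<close> f_mem that by (meson disjointD)
    qed
    ultimately have "f ` {1..r} \<in> edges (kneser_hypergraph r H)"
      unfolding kneser_hypergraph_def snd_conv by blast
    moreover have "\<forall>e \<in> f ` {1..r}. c e = i"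
      using f_mem by blast
    ultimately show False
      using c unfolding proper_coloring_def by blast
  qed
  have "\<forall>e\<in>M. c e \<in> {..<k}"
    using c M unfolding proper_coloring_def kneser_hypergraph_def by auto
  then have "M = (\<Union>i<k. {e \<in> M. c e = i})"
    by auto
  then have "card M \<le> (\<Sum>i<k. card {e \<in> M. c e = i})"
    by (metis card_UN_le finite_lessThan)
  also have "\<dots> \<le> (\<Sum>i<k. r - 1)"
    using fibre by (rule sum_mono)
  finally show ?thesis
    by simp
qed

section \<open>Equitable colorings of edgeless hypergraphs\<close>

text \<open>Without edges every coloring is proper, so the vertices can be numbered and colored
  cyclically modulo \<open>r\<close>.\<close>

lemma equitably_colorable_of_no_edges:
  assumes "r \<ge> 1" and fin: "finite (verts H)" and "edges H = {}"
  shows "equitably_colorable r H"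
proof -
  define n where "n = card (verts H)"
  obtain h where h: "bij_betw h (verts H) {0..<n}"
    using ex_bij_betw_finite_nat[OF fin] unfolding n_def by blast
  define c where "c v = h v mod r" for v
  have card: "card {v \<in> verts H. c v = i} = card {m \<in> {0..<n}. m mod r = i}" for i
  proof (rule bij_betw_same_card)
    show "bij_betw h {v \<in> verts H. c v = i} {m \<in> {0..<n}. m mod r = i}"
      using h unfolding bij_betw_def c_def inj_on_def by auto
  qed
  have step: "card {m \<in> {0..<n}. m mod r = i} \<le> card {m \<in> {0..<n}. m mod r = j} + 1"
    if "i < r" "j < r" for i j
  proof -
    \<comment> \<open>Drop the least number \<open>i\<close> of its residue class. The others are at
      least \<open>i + r\<close>, so the shift \<open>?g\<close> does not truncate; since
      \<open>j < r\<close>, it lowers every number and stays below \<open>n\<close>.\<close>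
    have "card ({m \<in> {0..<n}. m mod r = i} - {i}) \<le> card {m \<in> {0..<n}. m mod r = j}"
    proof (rule card_inj_on_le)
      let ?g = "\<lambda>m. m - i - r + j"
      have ge: "m \<ge> i + r" if "m mod r = i" "m \<noteq> i" for m
      proof -
        have "m = i + r * (m div r)" using that by (metis mod_mult_div_eq)
        moreover have "m div r \<noteq> 0" using that calculation by (metis add.right_neutral mult_0_right)
        ultimately show ?thesis
          by (metis One_nat_def Suc_leI add_le_cancel_left gr0I mult.right_neutral mult_le_mono2)
      qed
      show "inj_on ?g ({m \<in> {0..<n}. m mod r = i} - {i})"
      proof (rule inj_onI)
        fix x y
        assume "x \<in> {m \<in> {0..<n}. m mod r = i} - {i}" "y \<in> {m \<in> {0..<n}. m mod r = i} - {i}"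
          and eq: "?g x = ?g y"
        then have "x \<ge> i + r" "y \<ge> i + r"
          using ge[of x] ge[of y] by simp_all
        then show "x = y"
          using eq by linarith
      qed
      show "?g ` ({m \<in> {0..<n}. m mod r = i} - {i}) \<subseteq> {m \<in> {0..<n}. m mod r = j}"
      proof (rule image_subsetI)
        fix m assume m: "m \<in> {m \<in> {0..<n}. m mod r = i} - {i}"
        then have *: "m \<ge> i + r" using ge by auto
        have "m - i = r * (m div r)"
          using m by (metis (mono_tags, lifting) DiffD1 mem_Collect_eq minus_mod_eq_mult_div)
        then have "m - i - r = r * (m div r - 1)"
          by (simp add: diff_mult_distrib2)
        then have "?g m mod r = j"
          using that by simp
        moreover have "?g m < n"
          using m * that by auto
        ultimately show "?g m \<in> {m \<in> {0..<n}. m mod r = j}"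
          by simp
      qed
    qed simp
    moreover have "card {m \<in> {0..<n}. m mod r = i}
        \<le> card ({m \<in> {0..<n}. m mod r = i} - {i}) + 1"
      using diff_card_le_card_Diff[of "{i}" "{m \<in> {0..<n}. m mod r = i}"] by simp
    ultimately show ?thesis
      by linarith
  qed
  have "proper_coloring H r c"
    using assms unfolding proper_coloring_def c_def by auto
  moreover have "card {v \<in> verts H. c v = i} \<le> card {v \<in> verts H. c v = j} + 1"
    if "i < r" "j < r" for i j
    unfolding card by (rule step[OF that])
  ultimately show ?thesis
    unfolding equitably_colorable_def by blast
qed

section \<open>Complete multipartite graphs and their colorability defect\<close>

locale multipartite =
  fixes P :: "nat \<Rightarrow> 'a set" and n :: nat and H :: "'a hypergraph"
  assumes disj: "disjoint_family_on P {..<n}"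
    and fin: "\<And>i. i < n \<Longrightarrow> finite (P i)"
    and verts_eq: "verts H = (\<Union>i<n. P i)"
    and edges_eq: "edges H = {{u, v} | u v i j.
          i < n \<and> j < n \<and> i \<noteq> j \<and> u \<in> P i \<and> v \<in> P j}"
begin

lemma finite_verts: "finite (verts H)"
  using fin by (simp add: verts_eq)

lemma part_unique: "i < n \<Longrightarrow> j < n \<Longrightarrow> v \<in> P i \<Longrightarrow> v \<in> P j \<Longrightarrow> i = j"
  using disj unfolding disjoint_family_on_def by blast

lemma edgeI: "i < n \<Longrightarrow> j < n \<Longrightarrow> i \<noteq> j \<Longrightarrow> u \<in> P i \<Longrightarrow> v \<in> P j \<Longrightarrow> {u, v} \<in> edges H"
  unfolding edges_eq by blast

text \<open>The index of the part containing a vertex serves as its color.\<close>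

lemma colorable_parts: "colorable n H"
proof -
  have "\<exists>i. i < n \<and> v \<in> P i" if "v \<in> verts H" for v
    using that by (auto simp: verts_eq)
  then obtain c where c: "\<And>v. v \<in> verts H \<Longrightarrow> c v < n \<and> v \<in> P (c v)"
    by metis
  have cP: "c v = i" if "i < n" "v \<in> P i" for v i
    using c[of v] that part_unique[of "c v" i v] by (auto simp: verts_eq)
  have "\<not> (\<exists>a. \<forall>v\<in>e. c v = a)" if "e \<in> edges H" for e
    using that cP by (fastforce simp: edges_eq)
  then have "proper_coloring H n c"
    using c unfolding proper_coloring_def by blast
  then show ?thesis
    unfolding colorable_def by blast
qed

lemma colorability_defect_eq_0: "colorability_defect n H = 0"
proof -
  have "{e \<in> edges H. e \<subseteq> verts H} = edges H"
    by (auto simp: edges_eq verts_eq)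
  then have "induced H (verts H - {}) = H"
    by (simp add: induced_def)
  then show ?thesis
    unfolding colorability_defect_def using colorable_parts
    by (intro Least_eq_0 exI[of _ "{}"]) auto
qed

text \<open>This is how properness enters the bound on the equitable defect: a color class among the
  surviving vertices \<open>N\<close> stays inside one part.\<close>

lemma colors_differ:
  assumes "proper_coloring (induced H N) k c" "i < n" "j < n" "i \<noteq> j"
    and "u \<in> P i \<inter> N" "v \<in> P j \<inter> N"
  shows "c u \<noteq> c v"
proof -
  have "{u, v} \<in> edges (induced H N)"
    using assms by (auto simp: induced_def intro: edgeI)
  then show ?thesis
    using assms(1) unfolding proper_coloring_def by fastforce
qed

end

section \<open>One large part: the chromatic number of the Kneser hypergraph\<close>

text \<open>Writing \<open>r\<close> as \<open>Suc m\<close> avoids the truncated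
  \<open>r - 1\<close>: the small parts have indices below \<open>m\<close>, and \<open>P m\<close>
  is the large part.\<close>

locale multipartite_large_part = multipartite P "Suc m" H for P and m and H :: "'a hypergraph" +
  fixes t T :: nat
  assumes m_pos: "m \<ge> 1"
    and card_small: "\<And>i. i < m \<Longrightarrow> card (P i) = t"
    and card_large: "card (P m) = T"
    and T_ge: "T \<ge> Suc m * t + m"
begin

text \<open>This set has three uses: as a vertex cover, as one side of a matching, and as an optimal
  set to remove for an equitable coloring.\<close>

definition U :: "'a set" where
  "U = (\<Union>i<m. P i)"

lemma finite_U: "finite U"
  using fin by (simp add: U_def)

lemma card_U: "card U = t * m"
proof -
  have "card U = (\<Sum>i<m. card (P i))"
    unfolding U_def
  proof (rule card_UN_disjoint')
    show "disjoint_family_on P {..<m}"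
      by (rule disjoint_family_on_mono[OF _ disj]) auto
  qed (use fin in auto)
  then show ?thesis
    using card_small by simp
qed

lemma U_disjoint_large: "U \<inter> P m = {}"
proof -
  have "v \<notin> P m" if "v \<in> P i" "i < m" for v i
    using part_unique[of i m v] that by auto
  then show ?thesis
    unfolding U_def by blast
qed

lemma edge_meets_U: "e \<in> edges H \<Longrightarrow> e \<inter> U \<noteq> {}"
  unfolding edges_eq U_def by (auto simp: less_Suc_eq)

lemma chromatic_number_kneser_hypergraph:
  "chromatic_number (kneser_hypergraph (Suc m) H) = t"
  unfolding chromatic_number_def
proof (rule Least_equality)
  show "colorable t (kneser_hypergraph (Suc m) H)"
    using m_pos finite_U card_U edge_meets_U
    by (intro colorable_kneser_hypergraph_of_cover[of _ U]) auto
next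
  fix k assume k: "colorable k (kneser_hypergraph (Suc m) H)"
  \<comment> \<open>The large part has room for an injective image of \<open>U\<close>, which gives
    a matching of \<open>t * m\<close> edges.\<close>
  have "card U \<le> card (P m)"
    using card_U card_large T_ge by (simp add: mult.commute)
  then obtain \<phi> where \<phi>: "\<phi> ` U \<subseteq> P m" "inj_on \<phi> U"
    using finite_U fin by (metis card_le_inj lessI)
  define M where "M = (\<lambda>u. {u, \<phi> u}) ` U"
  have "\<phi> u \<notin> U" if "u \<in> U" for u
    using that \<phi> U_disjoint_large by blast
  then have inj: "inj_on (\<lambda>u. {u, \<phi> u}) U" and "disjoint M"
    using \<phi>(2) unfolding M_def inj_on_def disjoint_def by (auto simp: doubleton_eq_iff)
  have "M \<subseteq> edges H"
  proof
    fix e assume "e \<in> M"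
    then obtain u i where "e = {u, \<phi> u}" "i < m" "u \<in> P i" "\<phi> u \<in> P m"
      using \<phi>(1) unfolding M_def U_def by blast
    then show "e \<in> edges H"
      using edgeI[of i m u "\<phi> u"] by simp
  qed
  then have "card M \<le> k * (Suc m - 1)"
    using finite_U k \<open>disjoint M\<close>
    by (intro card_matching_le_of_colorable_kneser_hypergraph) (auto simp: M_def)
  then show "t \<le> k"
    using card_image[OF inj] card_U m_pos unfolding M_def by simp
qed

section \<open>The equitable colorability defect\<close>

text \<open>Two disjoint sets of removed vertices are counted: the small parts that vanish entirely,
  and the vertices of the large part for which the balanced color classes have no room.\<close>

lemma card_removed_ge:
  assumes S: "S \<subseteq> verts H" and eq: "equitably_colorable (Suc m) (induced H (verts H - S))"
  shows "t * m \<le> card S"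
proof -
  define N where "N = verts H - S"
  obtain c where c: "proper_coloring (induced H N) (Suc m) c"
    and bal: "\<And>i j. i < Suc m \<Longrightarrow> j < Suc m \<Longrightarrow>
      card {v \<in> N. c v = i} \<le> card {v \<in> N. c v = j} + 1"
    using eq unfolding equitably_colorable_def N_def induced_def by auto
  have c_lt: "c v < Suc m" if "v \<in> N" for v
    using c that unfolding proper_coloring_def induced_def by simp
  have finS: "finite S"
    using S finite_verts by (rule finite_subset)
  have finN: "finite N"
    unfolding N_def using finite_verts by simp
  \<comment> \<open>These are the small parts with a surviving vertex; \<open>card Q\<close> is the
    number q of the overview.\<close>
  define Q where "Q = {i. i < m \<and> P i \<inter> N \<noteq> {}}"
  have finQ: "finite Q" and Q_sub: "Q \<subseteq> {..<m}"
    unfolding Q_def by auto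
  define dead where "dead = (\<Union>i\<in>{..<m} - Q. P i)"
  have P_sub: "P i \<subseteq> verts H" if "i \<le> m" for i
    using that unfolding verts_eq by (intro UN_upper) simp
  have dead_S: "dead \<subseteq> S"
  proof
    fix v assume "v \<in> dead"
    then obtain i where "i < m" "i \<notin> Q" "v \<in> P i"
      unfolding dead_def by blast
    then show "v \<in> S"
      using P_sub[of i] unfolding Q_def N_def by auto
  qed
  have card_dead: "card dead = (m - card Q) * t"
  proof -
    have "card dead = (\<Sum>i\<in>{..<m} - Q. card (P i))"
      unfolding dead_def
    proof (rule card_UN_disjoint')
      show "disjoint_family_on P ({..<m} - Q)"
        by (rule disjoint_family_on_mono[OF _ disj]) auto
    qed (use fin in auto)
    then show ?thesis
      using card_small Q_sub finQ by (simp add: card_Diff_subset)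
  qed
  show ?thesis
  proof (cases "Q = {}")
    case True
    then show ?thesis
      using card_dead card_mono[OF finS dead_S] by (simp add: mult.commute)
  next
    case False
    have "\<forall>i\<in>Q. \<exists>v. v \<in> P i \<inter> N"
      unfolding Q_def by blast
    from bchoice[OF this] obtain w where w: "\<And>i. i \<in> Q \<Longrightarrow> w i \<in> P i \<inter> N"
      by blast
    have inj: "inj_on (\<lambda>i. c (w i)) Q"
    proof (rule inj_onI, rule ccontr)
      fix i j assume "i \<in> Q" "j \<in> Q" "c (w i) = c (w j)" "i \<noteq> j"
      then show False
        using colors_differ[OF c, of i j "w i" "w j"] w Q_sub by fastforce
    qed
    \<comment> \<open>Each surviving small part blocks the color of its representative
      \<open>w i\<close> for the large part, and these colors are distinct. Only the colors in
      \<open>L\<close> remain for the large part.\<close>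
    define L where "L = {..<Suc m} - (\<lambda>i. c (w i)) ` Q"
    have sub: "(\<lambda>i. c (w i)) ` Q \<subseteq> {..<Suc m}"
      using w c_lt by fastforce
    have card_L: "card L = Suc m - card Q"
      unfolding L_def using sub finQ by (simp add: card_Diff_subset card_image[OF inj])
    have large: "P m \<inter> N \<subseteq> (\<Union>k\<in>L. {v \<in> N. c v = k})"
    proof
      fix v assume v: "v \<in> P m \<inter> N"
      have "c (w i) \<noteq> c v" if "i \<in> Q" for i
        using colors_differ[OF c, of i m "w i" v] w[OF that] v that Q_sub by fastforce
      then show "v \<in> (\<Union>k\<in>L. {v \<in> N. c v = k})"
        using v c_lt unfolding L_def by fastforce
    qed
    obtain i where i: "i \<in> Q"
      using False by blast
    have im: "i < m"
      using i Q_sub by auto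
    \<comment> \<open>One class lies inside a small part and so has at most \<open>t\<close>
      vertices; balance then bounds every class by \<open>t + 1\<close>.\<close>
    have "{v \<in> N. c v = c (w i)} \<subseteq> P i"
    proof
      fix v assume v: "v \<in> {v \<in> N. c v = c (w i)}"
      then obtain j where j: "j < Suc m" "v \<in> P j"
        unfolding N_def verts_eq by auto
      then have "j = i"
        using colors_differ[OF c, of i j "w i" v] w[OF i] v im by fastforce
      then show "v \<in> P i"
        using j by simp
    qed
    then have "card {v \<in> N. c v = c (w i)} \<le> t"
      using card_mono[of "P i"] fin[of i] card_small[OF im] im by simp
    then have class_le: "card {v \<in> N. c v = k} \<le> t + 1" if "k < Suc m" for k
      using bal[OF that, of "c (w i)"] c_lt w[OF i] by fastforce
    have "card (P m \<inter> N) \<le> card (\<Union>k\<in>L. {v \<in> N. c v = k})"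
      by (rule card_mono) (use large finN in \<open>auto simp: L_def\<close>)
    also have "\<dots> \<le> (\<Sum>k\<in>L. card {v \<in> N. c v = k})"
      by (rule card_UN_le) (simp add: L_def)
    also have "\<dots> \<le> (\<Sum>k\<in>L. t + 1)"
      by (rule sum_mono) (use class_le in \<open>auto simp: L_def\<close>)
    finally have large_le: "card (P m \<inter> N) \<le> (Suc m - card Q) * (t + 1)"
      using card_L by simp
    have "P m = (P m \<inter> N) \<union> (P m \<inter> S)"
      using P_sub[of m] unfolding N_def by auto
    then have T_le: "T \<le> card (P m \<inter> N) + card (P m \<inter> S)"
      using card_Un_le card_large by metis
    have "dead \<inter> (P m \<inter> S) = {}"
      using U_disjoint_large unfolding dead_def U_def by blast
    then have "card dead + card (P m \<inter> S) = card (dead \<union> (P m \<inter> S))"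
      using finS dead_S by (metis card_Un_disjoint finite_Int finite_subset)
    also have "\<dots> \<le> card S"
      by (rule card_mono) (use finS dead_S in auto)
    finally have S_ge: "card dead + card (P m \<inter> S) \<le> card S" .
    \<comment> \<open>Here \<open>p\<close> counts the vanished small parts, so \<open>L\<close> has
      \<open>p + 1\<close> colors and truncated subtraction disappears.\<close>
    obtain p where p: "m = card Q + p"
      using card_mono[OF _ Q_sub] by (auto simp: le_iff_add)
    have "card Q \<ge> 1"
      using False finQ by (simp add: Suc_le_eq card_gt_0_iff)
    have dead_eq: "card dead = p * t" and large_le': "card (P m \<inter> N) \<le> (p + 1) * (t + 1)"
      using card_dead large_le p by simp_all
    have T_ge': "(card Q + p + 1) * t + card Q + p \<le> T"
      using T_ge p by simp
    \<comment> \<open>At least \<open>T - (p + 1) * (t + 1)\<close>, hence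
      \<open>card Q * t + card Q - 1\<close>, vertices of the large part are removed, besides the
      \<open>p * t\<close> in \<open>dead\<close>. The final \<open>+ 1\<close> absorbs the
      \<open>- 1\<close>, and is offset by \<open>card Q \<ge> 1\<close>.\<close>
    have "t * m + card Q \<le> card dead + card (P m \<inter> S) + 1"
      using dead_eq large_le' T_ge' T_le p
      by (simp add: algebra_simps)
    then show ?thesis
      using S_ge \<open>card Q \<ge> 1\<close> by linarith
  qed
qed

text \<open>Removing \<open>U\<close> leaves only the large part, which spans no edge and is split
  evenly; \<open>card_removed_ge\<close> shows that this is optimal.\<close>

lemma equitable_colorability_defect_eq:
  "equitable_colorability_defect (Suc m) H = t * m"
  unfolding equitable_colorability_defect_def
proof (rule Least_equality)
  have "equitably_colorable (Suc m) (induced H (verts H - U))"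
  proof (rule equitably_colorable_of_no_edges)
    show "edges (induced H (verts H - U)) = {}"
      unfolding induced_def using edge_meets_U by fastforce
  qed (use finite_verts in \<open>auto simp: induced_def\<close>)
  moreover have "U \<subseteq> verts H"
    unfolding U_def verts_eq by (intro UN_mono) auto
  ultimately show "\<exists>S\<subseteq>verts H. finite S \<and> card S = t * m \<and>
      equitably_colorable (Suc m) (induced H (verts H - S))"
    using finite_U card_U by blast
qed (use card_removed_ge in blast)

end

theorem proposition6:
  fixes r t T :: nat and H :: "'a hypergraph"
  assumes "r \<ge> 2" and "t \<ge> 1" and "T \<ge> 1"
    and "T \<ge> r * t + r - 1"
    and "complete_multipartite_graph (replicate (r - 1) t @ [T]) H"
  shows "colorability_defect r H = 0 \<and>
         real (chromatic_number (kneser_hypergraph r H))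
           = real (equitable_colorability_defect r H) / (real r - 1) \<and>
         real (equitable_colorability_defect r H) / (real r - 1) = real t"
proof -
  obtain m where r: "r = Suc m"
    using \<open>r \<ge> 2\<close> by (cases r) auto
  let ?ns = "replicate m t @ [T]"
  have ns: "replicate (r - 1) t @ [T] = ?ns" and len: "length ?ns = Suc m"
    by (simp_all add: r)
  obtain P where P: "disjoint_family_on P {..<Suc m}"
      "\<forall>i < Suc m. finite (P i) \<and> card (P i) = ?ns ! i"
      "verts H = (\<Union>i<Suc m. P i)"
      "edges H = {{u, v} | u v i j. i < Suc m \<and> j < Suc m \<and> i \<noteq> j \<and> u \<in> P i \<and> v \<in> P j}"
    using assms(5) unfolding complete_multipartite_graph_def ns len by (elim exE conjE)
  interpret multipartite_large_part P m H t T
  proof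
    show "finite (P i)" if "i < Suc m" for i
      using P(2) that by blast
    show "m \<ge> 1"
      using \<open>r \<ge> 2\<close> r by simp
    show "Suc m * t + m \<le> T"
      using assms(4) r by simp
    show "card (P i) = t" if "i < m" for i
      using P(2)[rule_format, of i] that by (simp add: nth_append)
    show "card (P m) = T"
      using P(2)[rule_format, of m] by (simp add: nth_append)
  qed (fact P)+
  show ?thesis
    \<comment> \<open>The denominator \<open>real r - 1\<close> is \<open>real m\<close>, which is
      positive and cancels against the defect \<open>t * m\<close>.\<close>
    using colorability_defect_eq_0 chromatic_number_kneser_hypergraph
      equitable_colorability_defect_eq m_pos
    by (simp add: r)
qed

end
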